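(* For all $\ell\in\mathbb{Z}_{\ge 0}$ and $n\in\mathbb{Z}_{\ge 1}$, $$B(\ell,n)=\sum_{t=0}^{n}\genfrac{\{}{\}}{0pt}{}{\ell}{t}=\frac{1}{n!}\sum_{\sigma\in S_n}F(\sigma)^{\ell}.$$
   Context: $S_n$ is the symmetric group on $\{1,\dots,n\}$ and $F(\sigma)$ is the number of fixed points of $\sigma\in S_n$, with the convention $0^0=1$. $\genfrac{\{}{\}}{0pt}{}{\ell}{t}$ is the Stirling number of the second kind, the number of set partitions of an $\ell$-element set into $t$ nonempty blocks (so $\genfrac{\{}{\}}{0pt}{}{0}{0}=1$). $B(\ell,n)$ is the $n$-restricted Bell number, the number of set partitions of an $\ell$-element set into at most $n$ blocks (equal to $1$ for $\ell=0$). *)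

theory Defs
  imports Complex_Main "HOL-Combinatorics.Permutations" "HOL-Combinatorics.Stirling"
    "HOL-Library.Disjoint_Sets"
begin

definition restricted_Bell :: "nat \<Rightarrow> nat \<Rightarrow> nat" where
  "restricted_Bell l n = card {P. partition_on {1..l} P \<and> card P \<le> n}"

definition fixed_points :: "nat \<Rightarrow> (nat \<Rightarrow> nat) \<Rightarrow> nat" where
  "fixed_points n \<sigma> = card {i \<in> {1..n}. \<sigma> i = i}"

text \<open>
  \<^const>\<open>Stirling\<close> is introduced in the library by its recurrence, without a link to set
  partitions. The lemmas below establish that it counts the partitions of an \<open>l\<close>-element set
  into \<open>t\<close> nonempty blocks.
\<close>

lemma card_partitions_insert:
  assumes fin: "finite A" and a: "a \<notin> A"
  shows "card {P. partition_on (insert a A) P \<and> card P = Suc k} =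
    Suc k * card {P. partition_on A P \<and> card P = Suc k} + card {P. partition_on A P \<and> card P = k}"
proof -
  define S where "S j = {P. partition_on A P \<and> card P = j}" for j
  define f where "f = (\<lambda>(P, B). insert (insert a B) (P - {B}))"
  have finS: "finite (S j)" for j
    unfolding S_def using finitely_many_partition_on[OF fin] by (rule rev_finite_subset) auto
  have fin_blocks: "finite P" if "P \<in> S j" for P j
    using that finite_elements[OF fin] by (auto simp: S_def)
  have notin: "a \<notin> X" if "P \<in> S j" "X \<in> P" for P j X
    using that a by (auto simp: S_def partition_on_def)
  have single: "insert {a} P \<in> {P. partition_on (insert a A) P \<and> card P = Suc k}" if P: "P \<in> S k" for P
  proof -
    have "disjnt {a} (\<Union>P)" "insert a A - {a} = A" "{a} \<notin> P"
      using notin[OF P] a by (auto simp: disjnt_def)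
    then show ?thesis
      using P fin_blocks[OF P] by (auto simp: partition_on_insert S_def)
  qed
  have enlarge: "f (P, B) \<in> {P. partition_on (insert a A) P \<and> card P = Suc k}"
    if P: "P \<in> S (Suc k)" and B: "B \<in> P" for P B
  proof -
    have part: "partition_on A P" using P by (simp add: S_def)
    have dis: "disjnt B (\<Union>(P - {B}))"
      using part B by (auto simp: partition_on_def disjoint_def disjnt_def)
    have "partition_on A (insert B (P - {B}))"
      using part B by (simp add: insert_absorb)
    then have rest: "partition_on (A - B) (P - {B})" "B \<subseteq> A"
      using partition_on_insert[OF dis] by auto
    have dis': "disjnt (insert a B) (\<Union>(P - {B}))"
      using dis notin[OF P] by (auto simp: disjnt_def)
    have "insert a A - insert a B = A - B"
      using a by auto
    then have "partition_on (insert a A) (f (P, B))"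
      unfolding f_def using partition_on_insert[OF dis'] rest by auto
    moreover have "insert a B \<notin> P - {B}"
      using notin[OF P] by auto
    then have "card (f (P, B)) = Suc k"
      using P B fin_blocks[OF P] by (simp add: f_def S_def card_Diff_singleton)
    ultimately show ?thesis by simp
  qed
  have cover: "Q \<in> insert {a} ` S k \<union> f ` Sigma (S (Suc k)) (\<lambda>P. P)"
    if Q: "partition_on (insert a A) Q" "card Q = Suc k" for Q
  proof -
    have finQ: "finite Q" using finite_elements[OF _ Q(1)] fin by simp
    obtain X where X: "X \<in> Q" "a \<in> X"
      using partition_onD1[OF Q(1)] by auto
    have dis: "disjnt X (\<Union>(Q - {X}))"
      using Q(1) X by (auto simp: partition_on_def disjoint_def disjnt_def)
    have ins: "insert X (Q - {X}) = Q"
      using X by auto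
    have rest: "partition_on (insert a A - X) (Q - {X})" "X \<subseteq> insert a A"
      using partition_on_insert[OF dis] Q(1) ins by auto
    have cardR: "card (Q - {X}) = k"
      using X Q(2) finQ by simp
    show ?thesis
    proof (cases "X = {a}")
      case True
      have "insert a A - X = A" using True a by auto
      then have "Q - {X} \<in> S k" using rest cardR by (simp add: S_def)
      moreover have "Q = insert {a} (Q - {X})" using ins True by simp
      ultimately show ?thesis by (intro UnI1) (rule image_eqI)
    next
      case False
      define B where "B = X - {a}"
      have XB: "X = insert a B" "a \<notin> B" "B \<noteq> {}"
        using X False by (auto simp: B_def)
      have disB: "disjnt B (\<Union>(Q - {X}))"
        using dis by (auto simp: B_def disjnt_def)
      have "insert a A - X = A - B" "B \<subseteq> A"
        using XB a rest(2) by auto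
      then have part: "partition_on A (insert B (Q - {X}))"
        using partition_on_insert[OF disB] rest(1) XB(3) by auto
      have BQ: "B \<notin> Q - {X}"
        using disB XB(3) by (auto simp: disjnt_def)
      have "insert B (Q - {X}) \<in> S (Suc k)"
        using part BQ finQ cardR by (simp add: S_def)
      moreover have "f (insert B (Q - {X}), B) = Q"
        using BQ ins XB(1) by (simp add: f_def)
      ultimately show ?thesis by (intro UnI2 image_eqI[of _ _ "(insert B (Q - {X}), B)"]) auto
    qed
  qed
  have split: "{P. partition_on (insert a A) P \<and> card P = Suc k} =
      insert {a} ` S k \<union> f ` Sigma (S (Suc k)) (\<lambda>P. P)"
  proof (intro subset_antisym subsetI)
    fix Q assume "Q \<in> {P. partition_on (insert a A) P \<and> card P = Suc k}"
    then show "Q \<in> insert {a} ` S k \<union> f ` Sigma (S (Suc k)) (\<lambda>P. P)"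
      using cover[of Q] by simp
  next
    fix Q assume "Q \<in> insert {a} ` S k \<union> f ` Sigma (S (Suc k)) (\<lambda>P. P)"
    then show "Q \<in> {P. partition_on (insert a A) P \<and> card P = Suc k}"
      by (elim UnE imageE SigmaE) (use single enlarge in simp_all)
  qed
  have disjoint_cases: "insert {a} ` S k \<inter> f ` Sigma (S (Suc k)) (\<lambda>P. P) = {}"
  proof -
    have False if "P \<in> S k" "P' \<in> S (Suc k)" "B \<in> P'" "insert {a} P = f (P', B)" for P P' B
    proof -
      have "{a} \<in> insert (insert a B) (P' - {B})"
        using that(4) unfolding f_def by auto
      then have "{a} = insert a B"
        using notin[OF that(2)] by auto
      then have "B = {}"
        using notin[OF that(2,3)] by auto
      then show False
        using that(2,3) by (auto simp: S_def partition_on_def)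
    qed
    then show ?thesis
      by (intro equals0I) (elim IntE imageE SigmaE, metis)
  qed
  have inj1: "inj_on (insert {a}) (S k)"
  proof (rule inj_onI)
    fix P P' assume "P \<in> S k" "P' \<in> S k" "insert {a} P = insert {a} P'"
    moreover from this have "{a} \<notin> P" "{a} \<notin> P'" using notin by blast+
    ultimately show "P = P'" by (metis insert_ident)
  qed
  have inj2: "inj_on f (Sigma (S (Suc k)) (\<lambda>P. P))"
  proof (rule inj_onI, clarify)
    fix P B P' B'
    assume P: "P \<in> S (Suc k)" "B \<in> P" and P': "P' \<in> S (Suc k)" "B' \<in> P'"
      and eq: "f (P, B) = f (P', B')"
    note n = notin[OF P(1)] and n' = notin[OF P'(1)]
    have "insert a B \<in> insert (insert a B') (P' - {B'})"
      using eq unfolding f_def by auto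
    then have "insert a B = insert a B'"
      using n' by auto
    then have BB: "B = B'"
      using n[OF P(2)] n'[OF P'(2)] by (simp add: insert_ident)
    have "insert a B \<notin> P - {B}" "insert a B \<notin> P' - {B}"
      using n n' by auto
    then have "P - {B} = P' - {B}"
      using eq BB by (simp add: f_def insert_ident)
    then have "P = P'"
      using P(2) P'(2) BB by (metis insert_Diff)
    with BB show "P = P' \<and> B = B'" by simp
  qed
  have "card (Sigma (S (Suc k)) (\<lambda>P. P)) = (\<Sum>P\<in>S (Suc k). card P)"
    using finS fin_blocks by (intro card_SigmaI) auto
  also have "\<dots> = Suc k * card (S (Suc k))"
    by (simp add: S_def)
  finally have "card (f ` Sigma (S (Suc k)) (\<lambda>P. P)) = Suc k * card (S (Suc k))"
    using card_image[OF inj2] by simp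
  moreover have "finite (Sigma (S (Suc k)) (\<lambda>P. P))"
    using finS fin_blocks by blast
  ultimately show ?thesis
    unfolding split using disjoint_cases finS card_image[OF inj1]
    by (simp add: card_Un_disjoint S_def)
qed

lemma card_partitions_eq_Stirling:
  assumes "finite A"
  shows "card {P. partition_on A P \<and> card P = t} = Stirling (card A) t"
  using assms
proof (induction A arbitrary: t rule: finite_induct)
  case empty
  show ?case
    by (cases t) (auto simp: partition_on_empty conj_commute cong: conj_cong)
next
  case (insert a A)
  show ?case
  proof (cases t)
    case 0
    have "card P \<noteq> 0" if "partition_on (insert a A) P" for P
    proof -
      have "finite P"
        using finite_elements[OF _ that] insert.hyps(1) by simp
      moreover have "P \<noteq> {}"
        using partition_onD1[OF that] by auto
      ultimately show ?thesis by simp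
    qed
    then have "{P. partition_on (insert a A) P \<and> card P = 0} = {}"
      by blast
    then show ?thesis
      unfolding 0 by (simp only: card.empty card_insert_disjoint[OF insert.hyps] Stirling.simps)
  next
    case (Suc k)
    then show ?thesis
      using card_partitions_insert[OF insert.hyps, of k] insert.IH insert.hyps by simp
  qed
qed

end

theory Submission
  imports Defs
begin

text \<open>
  The second equality says that the fixed-point count \<open>F\<close> of a uniformly random permutation of
  an \<open>n\<close>-element set has \<open>l\<close>-th moment \<open>\<Sum>t\<le>n. Stirling l t\<close>. The factorial moments of \<open>F\<close> are
  the accessible ones: \<open>F choose t\<close> counts the \<open>t\<close>-subsets fixed pointwise, and a given
  \<open>t\<close>-subset is fixed pointwise by exactly \<open>fact (n - t)\<close> permutations. Hence
  \<open>fact t * (F choose t)\<close> has expectation \<open>(n choose t) * fact t * fact (n - t) / fact n = 1\<close> for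
  every \<open>t \<le> n\<close> (\<open>sum_permutations_choose_fixed_points\<close>). Stirling numbers of the second
  kind are the coefficients that expand ordinary powers in falling factorials
  (\<open>power_eq_sum_Stirling_choose\<close>), so by linearity the \<open>l\<close>-th moment is the sum of these
  coefficients. Falling factorials of degree above \<open>n\<close> vanish at \<open>F \<le> n\<close>, which is why the
  sum stops at \<open>t = n\<close>.

  The first equality sorts the partitions counted by the restricted Bell number by their
  number of blocks.
\<close>

lemma card_partitions_at_most_eq_sum_Stirling:
  assumes "finite A"
  shows "card {P. partition_on A P \<and> card P \<le> n} = (\<Sum>t = 0..n. Stirling (card A) t)"
proof -
  have fin: "finite {P. partition_on A P \<and> card P = t}" for t
    using finitely_many_partition_on[OF assms] by (rule rev_finite_subset) auto
  have "{P. partition_on A P \<and> card P \<le> n} = (\<Union>t\<in>{0..n}. {P. partition_on A P \<and> card P = t})"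
    by auto
  also have "card \<dots> = (\<Sum>t = 0..n. card {P. partition_on A P \<and> card P = t})"
    by (intro card_UN_disjoint) (use fin in auto)
  finally show ?thesis
    by (simp add: card_partitions_eq_Stirling[OF assms])
qed

text \<open>
  Multiplying a falling factorial of degree \<open>t\<close> by \<open>x = t + (x - t)\<close> yields \<open>t\<close> times itself
  plus the one of degree \<open>t + 1\<close>.
\<close>

lemma mult_fact_choose:
  fixes x t :: nat
  shows "x * (fact t * (x choose t)) = t * (fact t * (x choose t)) + fact (Suc t) * (x choose Suc t)"
proof (cases "t \<le> x")
  case True
  then have "x * (fact t * (x choose t)) = (t + (x - t)) * (fact t * (x choose t))"
    by simp
  also have "\<dots> = t * (fact t * (x choose t)) + fact t * ((x - t) * (x choose t))"
    by (simp only: algebra_simps)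
  also have "(x - t) * (x choose t) = Suc t * (x choose Suc t)"
    by (simp only: binomial_absorb_comp binomial_absorption)
  finally show ?thesis
    by (simp only: fact_Suc of_nat_id algebra_simps)
qed (simp add: binomial_eq_0)

text \<open>
  By the preceding identity, the coefficients of \<open>x ^ l\<close> in the falling factorials obey the
  recurrence that defines the Stirling numbers. The upper limit \<open>m\<close> is any number \<open>\<ge> x\<close>, not
  \<open>l\<close>, so that one range of summation serves all the fixed-point counts of permutations of an
  \<open>m\<close>-element set.
\<close>

lemma power_eq_sum_Stirling_choose:
  fixes x m l :: nat
  assumes "x \<le> m"
  shows "x ^ l = (\<Sum>t = 0..m. Stirling l t * (fact t * (x choose t)))"
proof (induction l)
  case 0
  have "(\<Sum>t = 0..m. Stirling 0 t * (fact t * (x choose t)))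
      = (\<Sum>t\<in>{0}. Stirling 0 t * (fact t * (x choose t)))"
    by (intro sum.mono_neutral_right) (auto simp: gr0_conv_Suc)
  then show ?case by simp
next
  case (Suc l)
  define g where "g t = fact t * (x choose t)" for t
  have "x ^ Suc l = (\<Sum>t = 0..m. Stirling l t * (x * g t))"
    by (simp add: Suc.IH g_def sum_distrib_left mult_ac)
  also have "\<dots> = (\<Sum>t = 0..m. t * Stirling l t * g t) + (\<Sum>t = 0..m. Stirling l t * g (Suc t))"
    unfolding g_def mult_fact_choose
    by (simp only: distrib_left sum.distrib mult_ac)
  also have "(\<Sum>t = 0..m. t * Stirling l t * g t)
      = (\<Sum>t = 0..m. Suc t * Stirling l (Suc t) * g (Suc t))"
  proof -
    \<comment> \<open>The shift drops the term \<open>t = 0\<close>, which has the factor \<open>0\<close>, and adds the term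
      \<open>t = m + 1\<close>, which vanishes because \<open>x \<le> m\<close>.\<close>
    have "g (Suc m) = 0"
      using assms by (simp add: g_def)
    then have "(\<Sum>t = 0..m. t * Stirling l t * g t) = (\<Sum>t = 0..Suc m. t * Stirling l t * g t)"
      by simp
    then show ?thesis
      by (simp only: sum.atLeast0_atMost_Suc_shift comp_def mult_0 add_0)
  qed
  also have "\<dots> + (\<Sum>t = 0..m. Stirling l t * g (Suc t))
      = (\<Sum>t = 0..m. Stirling (Suc l) (Suc t) * g (Suc t))"
    by (simp only: Stirling.simps sum.distrib distrib_right)
  also have "\<dots> = (\<Sum>t = 0..Suc m. Stirling (Suc l) t * g t)"
    by (simp only: sum.atLeast0_atMost_Suc_shift comp_def Stirling.simps mult_0 add_0)
  also have "\<dots> = (\<Sum>t = 0..m. Stirling (Suc l) t * g t)"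
    using assms by (simp add: g_def)
  finally show ?case
    by (simp only: g_def)
qed

lemma permutes_fixing_iff_permutes_Diff:
  assumes "T \<subseteq> A"
  shows "\<sigma> permutes A \<and> (\<forall>i\<in>T. \<sigma> i = i) \<longleftrightarrow> \<sigma> permutes (A - T)"
  using assms permutes_superset[of \<sigma> A "A - T"] permutes_subset[of \<sigma> "A - T" A]
  by (auto dest: permutes_not_in)

text \<open>
  This double counts the pairs of a permutation and a \<open>t\<close>-subset that it fixes pointwise: the
  permutations belonging to a subset \<open>T\<close> are those of its complement, so their number depends
  on \<open>t\<close> alone, and the factors combine to \<open>fact (card A)\<close> whatever \<open>t\<close> is.
\<close>

lemma sum_permutations_choose_fixed_points:
  assumes A: "finite A" and t: "t \<le> card A"
  shows "(\<Sum>\<sigma> | \<sigma> permutes A. fact t * (card {i \<in> A. \<sigma> i = i} choose t)) = fact (card A)"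
proof -
  define S where "S = {\<sigma>. \<sigma> permutes A}"
  define C where "C = {T. T \<subseteq> A \<and> card T = t}"
  have finS: "finite S" and finC: "finite C"
    using A by (simp_all add: S_def C_def finite_permutations)
  have "card {i \<in> A. \<sigma> i = i} choose t = card {T \<in> C. \<forall>i\<in>T. \<sigma> i = i}" for \<sigma>
  proof -
    have "{T \<in> C. \<forall>i\<in>T. \<sigma> i = i} = {T. T \<subseteq> {i \<in> A. \<sigma> i = i} \<and> card T = t}"
      by (auto simp: C_def)
    then show ?thesis
      using A by (simp add: n_subsets)
  qed
  then have "(\<Sum>\<sigma>\<in>S. card {i \<in> A. \<sigma> i = i} choose t)
      = (\<Sum>\<sigma>\<in>S. \<Sum>T | T \<in> C \<and> (\<forall>i\<in>T. \<sigma> i = i). 1)"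
    by simp
  also have "\<dots> = (\<Sum>T\<in>C. \<Sum>\<sigma> | \<sigma> \<in> S \<and> (\<forall>i\<in>T. \<sigma> i = i). 1)"
    by (rule sum.swap_restrict[OF finS finC])
  also have "\<dots> = (\<Sum>T\<in>C. fact (card A - t))"
  proof (rule sum.cong[OF refl])
    fix T assume T: "T \<in> C"
    then have "{\<sigma>. \<sigma> \<in> S \<and> (\<forall>i\<in>T. \<sigma> i = i)} = {\<sigma>. \<sigma> permutes (A - T)}"
      by (simp add: S_def C_def permutes_fixing_iff_permutes_Diff)
    moreover have "card (A - T) = card A - t"
      using T finite_subset[OF _ A] by (auto simp: C_def card_Diff_subset)
    ultimately show "(\<Sum>\<sigma> | \<sigma> \<in> S \<and> (\<forall>i\<in>T. \<sigma> i = i). 1) = fact (card A - t)"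
      using A by (simp add: card_permutations)
  qed
  also have "\<dots> = (card A choose t) * fact (card A - t)"
    using A by (simp add: C_def n_subsets)
  finally show ?thesis
    using binomial_fact_lemma[OF t] by (simp add: S_def mult_ac flip: sum_distrib_left)
qed

lemma sum_permutations_power_fixed_points:
  assumes "finite A"
  shows "(\<Sum>\<sigma> | \<sigma> permutes A. card {i \<in> A. \<sigma> i = i} ^ l)
    = fact (card A) * (\<Sum>t = 0..card A. Stirling l t)"
proof -
  have "(\<Sum>\<sigma> | \<sigma> permutes A. card {i \<in> A. \<sigma> i = i} ^ l)
      = (\<Sum>\<sigma> | \<sigma> permutes A. \<Sum>t = 0..card A.
          Stirling l t * (fact t * (card {i \<in> A. \<sigma> i = i} choose t)))"
    using assms by (intro sum.cong refl power_eq_sum_Stirling_choose card_mono) auto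
  also have "\<dots> = (\<Sum>t = 0..card A. Stirling l t *
      (\<Sum>\<sigma> | \<sigma> permutes A. fact t * (card {i \<in> A. \<sigma> i = i} choose t)))"
    by (subst sum.swap) (simp only: sum_distrib_left)
  also have "\<dots> = (\<Sum>t = 0..card A. Stirling l t * fact (card A))"
    using assms by (intro sum.cong refl) (simp only: sum_permutations_choose_fixed_points atLeastAtMost_iff)
  finally show ?thesis
    by (simp add: sum_distrib_left mult_ac)
qed

theorem corollary3p10:
  fixes l n :: nat
  assumes "n \<ge> 1"
  shows "restricted_Bell l n = (\<Sum>t = 0..n. Stirling l t) \<and>
    real (\<Sum>t = 0..n. Stirling l t) =
      1 / fact n * (\<Sum>\<sigma> | \<sigma> permutes {1..n}. real (fixed_points n \<sigma>) ^ l)"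
proof
  show "restricted_Bell l n = (\<Sum>t = 0..n. Stirling l t)"
    using card_partitions_at_most_eq_sum_Stirling[of "{1..l}" n] by (simp add: restricted_Bell_def)
  have "(\<Sum>\<sigma> | \<sigma> permutes {1..n}. fixed_points n \<sigma> ^ l) = fact n * (\<Sum>t = 0..n. Stirling l t)"
    using sum_permutations_power_fixed_points[of "{1..n}" l] by (simp add: fixed_points_def)
  then have "(\<Sum>\<sigma> | \<sigma> permutes {1..n}. real (fixed_points n \<sigma>) ^ l)
      = fact n * real (\<Sum>t = 0..n. Stirling l t)"
    by (metis (no_types, lifting) of_nat_fact of_nat_mult of_nat_power of_nat_sum sum.cong)
  then show "real (\<Sum>t = 0..n. Stirling l t) =
      1 / fact n * (\<Sum>\<sigma> | \<sigma> permutes {1..n}. real (fixed_points n \<sigma>) ^ l)"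
    by simp
qed

end
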